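(* Let $\mathcal C_1$ and $\mathcal C_2$ be nonempty closed convex sets in a finite-dimensional Euclidean space. Then $$(\mathcal C_1\cup\mathcal C_2)'=\mathcal C_1'\cap\mathcal C_2'.$$ If $0\notin\operatorname{cl}\operatorname{conv}(\mathcal C_1\cup\mathcal C_2)$, then the sets above are nonempty.
   Context: The antipolar of a set $\mathcal D$ is $\mathcal D'=\{y\mid\langle y,x\rangle\ge1\ \forall x\in\mathcal D\}$. $\operatorname{conv}$ and $\operatorname{cl}$ denote convex hull and closure. *)

theory Defs
  imports "HOL-Analysis.Analysis"
begin

definition antipolar :: "'a::real_inner set \<Rightarrow> 'a set"
  where "antipolar D = {y. \<forall>x\<in>D. inner y x \<ge> 1}"

end

theory Submission
  imports Defs
begin

text \<open>The identity holds because a condition on all points of a union splits into one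
  condition per set. Nonemptiness is strict separation from the origin: the normal of a separating
  hyperplane, suitably scaled, is an antipolar point (\<open>antipolar_nonempty\<close>).\<close>

lemma antipolar_Un: "antipolar (A \<union> B) = antipolar A \<inter> antipolar B"
  by (auto simp: antipolar_def)

text \<open>Separation is applied to the closed convex hull, so \<open>D\<close> itself may be
  neither closed nor convex.\<close>

lemma antipolar_nonempty:
  fixes D :: "'a::euclidean_space set"
  assumes "0 \<notin> closure (convex hull D)"
  shows "antipolar D \<noteq> {}"
proof -
  have "convex (closure (convex hull D))"
    by (simp add: convex_closure)
  then obtain a b where b: "0 < b" and ab: "\<And>x. x \<in> closure (convex hull D) \<Longrightarrow> b < inner a x"
    using separating_hyperplane_closed_0[OF _ closed_closure assms] by blast
  have "D \<subseteq> closure (convex hull D)"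
    using hull_subset[of D convex] closure_subset[of "convex hull D"] by order
  \<comment> \<open>Since \<open>b > 0\<close>, dividing \<open>b < inner a x\<close> by
    \<open>b\<close> turns the separation threshold into 1.\<close>
  then have "a /\<^sub>R b \<in> antipolar D"
    using b ab by (fastforce simp: antipolar_def field_simps)
  then show ?thesis by blast
qed

theorem proposition3p6:
  fixes C1 C2 :: "'a::euclidean_space set"
  assumes "C1 \<noteq> {}" and "closed C1" and "convex C1"
    and "C2 \<noteq> {}" and "closed C2" and "convex C2"
  shows "antipolar (C1 \<union> C2) = antipolar C1 \<inter> antipolar C2 \<and>
    (0 \<notin> closure (convex hull (C1 \<union> C2)) \<longrightarrow>
      antipolar (C1 \<union> C2) \<noteq> {} \<and> antipolar C1 \<inter> antipolar C2 \<noteq> {})"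
  using antipolar_nonempty[of "C1 \<union> C2"] antipolar_Un[of C1 C2] by simp

end
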